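(* Let $M,N,K$ be positive integers, $\mathbf A\in\mathbb R^{M\times N}$ with $\mathbf A\ne\mathbf 0$, $\lambda>0$, $c_1=3$, $c_2=\|\mathbf A\|_F$. On $\mathbb R^{M\times K}\times\mathbb R^{K\times N}$ let $g(\mathbf U,\mathbf Z)=\frac12\|\mathbf A-\mathbf U\mathbf Z\|_F^2$, $f(\mathbf U,\mathbf Z)=\mathbf I_{\mathbf U\ge\mathbf 0}+\mathbf I_{\mathbf Z\ge\mathbf 0}$, and $$h(\mathbf U,\mathbf Z)=c_1\Big(\tfrac{\|\mathbf U\|_F^2+\|\mathbf Z\|_F^2}{2}\Big)^2+c_2\,\tfrac{\|\mathbf U\|_F^2+\|\mathbf Z\|_F^2}{2}.$$ Then the BPG-MF update $(\mathbf U^{k+1},\mathbf Z^{k+1})$ from $(\mathbf U^k,\mathbf Z^k)$ is given by $$\mathbf U^{k+1}=r\,\Pi_+(-\mathbf P^k),\qquad \mathbf Z^{k+1}=r\,\Pi_+(-\mathbf Q^k),$$ where $r\ge 0$ satisfies $$c_1\big(\|\Pi_+(-\mathbf Q^k)\|_F^2+\|\Pi_+(-\mathbf P^k)\|_F^2\big)r^3+c_2r-1=0 .$$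
   Context: $\|\cdot\|_F$ and $\langle\cdot,\cdot\rangle$ are the Frobenius norm and inner product. $\mathbf I_{\mathbf X\ge\mathbf 0}$ is the indicator function equal to $0$ if all entries of $\mathbf X$ are non-negative and $+\infty$ otherwise. $\Pi_+(\cdot)=\max\{0,\cdot\}$ applied entrywise. BPG-MF update: given $\lambda>0$, functions $f,g,h$ on $\mathbb R^{M\times K}\times\mathbb R^{K\times N}$ with $g,h$ differentiable, and a current iterate $(\mathbf U^k,\mathbf Z^k)\in\mathbb R^{M\times K}\times\mathbb R^{K\times N}$, put $\mathbf P^k=\lambda\nabla_{\mathbf U}g(\mathbf U^k,\mathbf Z^k)-\nabla_{\mathbf U}h(\mathbf U^k,\mathbf Z^k)$ and $\mathbf Q^k=\lambda\nabla_{\mathbf Z}g(\mathbf U^k,\mathbf Z^k)-\nabla_{\mathbf Z}h(\mathbf U^k,\mathbf Z^k)$; the update is $$(\mathbf U^{k+1},\mathbf Z^{k+1})\in\operatorname*{argmin}_{(\mathbf U,\mathbf Z)\in\mathbb R^{M\times K}\times\mathbb R^{K\times N}}\{\lambda f(\mathbf U,\mathbf Z)+\langle\mathbf P^k,\mathbf U\rangle+\langle\mathbf Q^k,\mathbf Z\rangle+h(\mathbf U,\mathbf Z)\}.$$ *)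

theory Defs
  imports "HOL-Analysis.Analysis"
begin

text \<open>A real \<open>m \<times> n\<close> matrix has type \<open>real^'n^'m\<close>. The library's \<open>norm\<close> and \<open>\<bullet>\<close> on this
  type are the Frobenius norm and the Frobenius inner product.\<close>

text \<open>Only meaningful at points where \<open>F\<close> is differentiable.\<close>

definition grad :: "('a::real_inner \<Rightarrow> real) \<Rightarrow> 'a \<Rightarrow> 'a" where
  "grad F x = (THE D. GDERIV F x :> D)"

definition nonneg_ind :: "real^'n^'m \<Rightarrow> ereal" where
  "nonneg_ind X = (if \<forall>i j. 0 \<le> X $ i $ j then 0 else \<infinity>)"

definition Pi_plus :: "real^'n^'m \<Rightarrow> real^'n^'m" where
  "Pi_plus X = (\<chi> i j. max 0 (X $ i $ j))"

definition bpg_P :: "real \<Rightarrow> (real^'k^'m \<Rightarrow> real^'n^'k \<Rightarrow> real) \<Rightarrow>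
    (real^'k^'m \<Rightarrow> real^'n^'k \<Rightarrow> real) \<Rightarrow> real^'k^'m \<Rightarrow> real^'n^'k \<Rightarrow> real^'k^'m" where
  "bpg_P lam g h U Z = lam *\<^sub>R grad (\<lambda>V. g V Z) U - grad (\<lambda>V. h V Z) U"

definition bpg_Q :: "real \<Rightarrow> (real^'k^'m \<Rightarrow> real^'n^'k \<Rightarrow> real) \<Rightarrow>
    (real^'k^'m \<Rightarrow> real^'n^'k \<Rightarrow> real) \<Rightarrow> real^'k^'m \<Rightarrow> real^'n^'k \<Rightarrow> real^'n^'k" where
  "bpg_Q lam g h U Z = lam *\<^sub>R grad (\<lambda>W. g U W) Z - grad (\<lambda>W. h U W) Z"

text \<open>The set of all admissible next iterates from \<open>(Uk, Zk)\<close>. The objective is \<open>ereal\<close>-valued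
  because \<open>f\<close> may encode constraints.\<close>

definition bpg_mf_update :: "real \<Rightarrow> (real^'k^'m \<Rightarrow> real^'n^'k \<Rightarrow> ereal) \<Rightarrow>
    (real^'k^'m \<Rightarrow> real^'n^'k \<Rightarrow> real) \<Rightarrow> (real^'k^'m \<Rightarrow> real^'n^'k \<Rightarrow> real) \<Rightarrow>
    real^'k^'m \<Rightarrow> real^'n^'k \<Rightarrow> ((real^'k^'m) \<times> (real^'n^'k)) set" where
  "bpg_mf_update lam f g h Uk Zk =
    {x. is_arg_min
      (\<lambda>(U, Z). ereal lam * f U Z +
        ereal (bpg_P lam g h Uk Zk \<bullet> U + bpg_Q lam g h Uk Zk \<bullet> Z + h U Z))
      (\<lambda>_. True) x}"

end

theory Submission imports Defs begin

text \<open>Why the update has this form. Write \<open>x = (U, Z)\<close> and \<open>w = (\<Pi>\<^sub>+(-P), \<Pi>\<^sub>+(-Q))\<close>. On the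
  feasible cone (both blocks entrywise nonnegative) the linear part of the objective satisfies
  \<open>\<langle>P, U\<rangle> + \<langle>Q, Z\<rangle> \<ge> - \<langle>w, x\<rangle>\<close>, because the discarded negative entries of \<open>-P\<close> and \<open>-Q\<close> are
  multiplied by nonnegative numbers; equality holds at nonnegative multiples of \<open>w\<close>
  (lemmas \<open>inner_ge_minus_inner_Pi_plus\<close> and \<open>inner_Pi_plus_minus\<close>).

  So the constrained objective is bounded below by the unconstrained, radially symmetric
  perturbation \<open>- \<langle>w, x\<rangle> + c\<^sub>1 \<parallel>x\<parallel>\<^sup>4/4 + c\<^sub>2 \<parallel>x\<parallel>\<^sup>2/2\<close>, with equality on the ray through \<open>w\<close>. This
  bound is strictly convex, and its stationarity equation \<open>w = (c\<^sub>1 \<parallel>x\<parallel>\<^sup>2 + c\<^sub>2) x\<close> on the ray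
  \<open>x = r w\<close> is implied by the cubic equation for \<open>r\<close>. Completing squares
  (\<open>quartic_excess_at_critical_point\<close>) replaces both the convexity argument and a coercivity
  argument: it exhibits the excess over the stationary value as a sum of squares that vanishes only
  at the stationary point, which gives existence and uniqueness of the minimizer at once.\<close>

lemma cubic_has_nonneg_root:
  fixes a b :: real
  assumes "a \<ge> 0" "b > 0"
  shows "\<exists>r\<ge>0. a * r ^ 3 + b * r - 1 = 0"
proof -
  \<comment> \<open>At \<open>1/b\<close> the linear part vanishes, so the cubic is nonnegative there; at 0 it is -1.\<close>
  have "\<exists>r\<ge>0. r \<le> 1 / b \<and> a * r ^ 3 + b * r - 1 = 0"
    by (rule IVT') (use assms in \<open>auto intro!: continuous_intros\<close>)
  then show ?thesis by blast
qed

text \<open>The polarization identity turns \<open>x0 \<bullet> x\<close> into squared norms and a squared distance; what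
  remains is a quadratic polynomial in \<open>\<parallel>x\<parallel>\<^sup>2\<close> with a double zero at \<open>\<parallel>x0\<parallel>\<^sup>2\<close>.\<close>

lemma quartic_excess_at_critical_point:
  fixes x x0 w :: "'a::real_inner" and c1 c2 :: real
  defines "F \<equiv> \<lambda>y. - (w \<bullet> y) + c1 * ((norm y)\<^sup>2 / 2)\<^sup>2 + c2 * ((norm y)\<^sup>2 / 2)"
  assumes crit: "w = (c1 * (norm x0)\<^sup>2 + c2) *\<^sub>R x0"
  shows "F x - F x0 = (c1 * (norm x0)\<^sup>2 + c2) / 2 * (norm (x - x0))\<^sup>2
           + c1 / 4 * ((norm x)\<^sup>2 - (norm x0)\<^sup>2)\<^sup>2"
proof -
  have polar: "(norm (x - x0))\<^sup>2 = (norm x)\<^sup>2 + (norm x0)\<^sup>2 - 2 * (x0 \<bullet> x)"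
    by (simp add: power2_norm_eq_inner inner_diff_left inner_diff_right inner_commute)
  have "w \<bullet> y = (c1 * (norm x0)\<^sup>2 + c2) * (x0 \<bullet> y)" for y
    by (subst crit) simp
  moreover have "x0 \<bullet> x0 = (norm x0)\<^sup>2"
    by (simp add: power2_norm_eq_inner)
  ultimately have w_inner: "w \<bullet> x = (c1 * (norm x0)\<^sup>2 + c2) * (x0 \<bullet> x)"
      "w \<bullet> x0 = (c1 * (norm x0)\<^sup>2 + c2) * (norm x0)\<^sup>2"
    by simp_all
  show ?thesis
    unfolding F_def polar w_inner
    by (simp add: algebra_simps power2_eq_square add_divide_distrib diff_divide_distrib)
qed

lemma inner_ge_minus_inner_Pi_plus:
  fixes P U :: "real^'n^'m"
  assumes "\<forall>i j. 0 \<le> U $ i $ j"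
  shows "- (Pi_plus (- P) \<bullet> U) \<le> P \<bullet> U"
proof -
  have "0 \<le> (P + Pi_plus (- P)) \<bullet> U"
    unfolding inner_vec_def using assms
    by (auto simp: Pi_plus_def intro!: sum_nonneg mult_nonneg_nonneg)
  then show ?thesis by (simp add: inner_add_left)
qed

text \<open>An entry of \<open>-P\<close> and its positive part have the same product with that positive part.\<close>

lemma inner_Pi_plus_minus:
  fixes P :: "real^'n^'m"
  shows "P \<bullet> Pi_plus (- P) = - (Pi_plus (- P) \<bullet> Pi_plus (- P))"
proof -
  have "(P + Pi_plus (- P)) \<bullet> Pi_plus (- P) = 0"
    unfolding inner_vec_def
    by (auto simp: Pi_plus_def max_def intro!: sum.neutral)
  then show ?thesis by (simp add: inner_add_left)
qed

lemma is_arg_min_eq_singleton: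
  fixes J :: "'a \<Rightarrow> 'b::order"
  assumes "\<And>x. x \<noteq> x0 \<Longrightarrow> J x0 < J x"
  shows "{x. is_arg_min J (\<lambda>_. True) x} = {x0}"
  unfolding is_arg_min_def using assms by (auto dest: less_asym)

text \<open>The objective lies above the strictly convex function \<open>F\<close> everywhere (trivially where it is
  infinite) and touches it at \<open>r w\<close>, which is also the strict minimizer of \<open>F\<close>; hence it is the
  unique minimizer of the objective.\<close>

lemma nonneg_quartic_argmin:
  fixes P :: "real^'k^'m" and Q :: "real^'n^'k" and lam c1 c2 r :: real
  assumes "lam > 0" "c1 \<ge> 0" "c2 > 0" "r \<ge> 0"
    and root: "c1 * ((norm (Pi_plus (- Q)))\<^sup>2 + (norm (Pi_plus (- P)))\<^sup>2) * r ^ 3 + c2 * r - 1 = 0"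
  shows "{x. is_arg_min (\<lambda>(U, Z). ereal lam * (nonneg_ind U + nonneg_ind Z) +
            ereal (P \<bullet> U + Q \<bullet> Z + (c1 * (((norm U)\<^sup>2 + (norm Z)\<^sup>2) / 2)\<^sup>2
                    + c2 * (((norm U)\<^sup>2 + (norm Z)\<^sup>2) / 2)))) (\<lambda>_. True) x}
         = {(r *\<^sub>R Pi_plus (- P), r *\<^sub>R Pi_plus (- Q))}"
proof (rule is_arg_min_eq_singleton)
  let ?J = "\<lambda>(U, Z). ereal lam * (nonneg_ind U + nonneg_ind Z) +
            ereal (P \<bullet> U + Q \<bullet> Z + (c1 * (((norm U)\<^sup>2 + (norm Z)\<^sup>2) / 2)\<^sup>2
                    + c2 * (((norm U)\<^sup>2 + (norm Z)\<^sup>2) / 2)))"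
  define w where "w = (Pi_plus (- P), Pi_plus (- Q))"
  define x0 where "x0 = r *\<^sub>R w"
  define F where "F y = - (w \<bullet> y) + c1 * ((norm y)\<^sup>2 / 2)\<^sup>2 + c2 * ((norm y)\<^sup>2 / 2)" for y
  have x0_eq: "(r *\<^sub>R Pi_plus (- P), r *\<^sub>R Pi_plus (- Q)) = x0"
    by (simp add: x0_def w_def)
  have norm_pair: "(norm (U, Z))\<^sup>2 = (norm U)\<^sup>2 + (norm Z)\<^sup>2"
    for U :: "real^'k^'m" and Z :: "real^'n^'k"
    by (simp add: norm_Pair)
  have crit: "w = (c1 * (norm x0)\<^sup>2 + c2) *\<^sub>R x0"
  proof -
    have "(c1 * (norm x0)\<^sup>2 + c2) * r = c1 * (norm w)\<^sup>2 * r ^ 3 + c2 * r"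
      by (simp add: x0_def power_mult_distrib power2_eq_square power3_eq_cube algebra_simps)
    also have "\<dots> = 1"
      using root by (simp add: w_def norm_pair add.commute)
    finally show ?thesis by (simp add: x0_def)
  qed
  have J_x0: "?J x0 = ereal (F x0)"
  proof -
    have "\<forall>i j. 0 \<le> (r *\<^sub>R Pi_plus (- P)) $ i $ j" "\<forall>i j. 0 \<le> (r *\<^sub>R Pi_plus (- Q)) $ i $ j"
      using \<open>r \<ge> 0\<close> by (simp_all add: Pi_plus_def)
    then have "?J (r *\<^sub>R Pi_plus (- P), r *\<^sub>R Pi_plus (- Q))
        = ereal (F (r *\<^sub>R Pi_plus (- P), r *\<^sub>R Pi_plus (- Q)))"
      by (simp add: nonneg_ind_def F_def w_def inner_Pi_plus_minus norm_pair)
    then show ?thesis by (simp only: x0_eq)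
  qed
  have F_le_J: "ereal (F x) \<le> ?J x" for x
  proof (cases x)
    case (Pair U Z)
    show ?thesis
    proof (cases "(\<forall>i j. 0 \<le> U $ i $ j) \<and> (\<forall>i j. 0 \<le> Z $ i $ j)")
      case True
      then have "- (Pi_plus (- P) \<bullet> U) \<le> P \<bullet> U" "- (Pi_plus (- Q) \<bullet> Z) \<le> Q \<bullet> Z"
        by (auto intro: inner_ge_minus_inner_Pi_plus)
      then have "F (U, Z) \<le> P \<bullet> U + Q \<bullet> Z + (c1 * (((norm U)\<^sup>2 + (norm Z)\<^sup>2) / 2)\<^sup>2
                    + c2 * (((norm U)\<^sup>2 + (norm Z)\<^sup>2) / 2))"
        by (simp add: F_def w_def norm_pair)
      with True show ?thesis by (simp add: Pair nonneg_ind_def)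
    next
      case False
      then have "nonneg_ind U + nonneg_ind Z = \<infinity>"
        by (auto simp: nonneg_ind_def)
      with \<open>lam > 0\<close> show ?thesis by (simp add: Pair del: ereal_plus_eq_PInfty)
    qed
  qed
  fix x assume "x \<noteq> (r *\<^sub>R Pi_plus (- P), r *\<^sub>R Pi_plus (- Q))"
  then have "x \<noteq> x0" by (simp only: x0_eq not_False_eq_True)
  have "c1 * (norm x0)\<^sup>2 + c2 > 0"
    using \<open>c1 \<ge> 0\<close> \<open>c2 > 0\<close> by (simp add: add_nonneg_pos)
  then have "(c1 * (norm x0)\<^sup>2 + c2) / 2 * (norm (x - x0))\<^sup>2 > 0"
    using \<open>x \<noteq> x0\<close> by (intro mult_pos_pos) auto
  moreover have "c1 / 4 * ((norm x)\<^sup>2 - (norm x0)\<^sup>2)\<^sup>2 \<ge> 0"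
    using \<open>c1 \<ge> 0\<close> by simp
  ultimately have "F x0 < F x"
    using quartic_excess_at_critical_point[OF crit, of x] unfolding F_def by linarith
  then have "ereal (F x0) < ereal (F x)" by simp
  also note F_le_J[of x]
  finally show "?J (r *\<^sub>R Pi_plus (- P), r *\<^sub>R Pi_plus (- Q)) < ?J x"
    using J_x0 by (simp only: x0_eq)
qed

theorem propositionD1:
  fixes A :: "real^'n^'m" and Uk :: "real^'k^'m" and Zk :: "real^'n^'k"
    and lam c1 c2 :: real
    and f :: "real^'k^'m \<Rightarrow> real^'n^'k \<Rightarrow> ereal"
    and g h :: "real^'k^'m \<Rightarrow> real^'n^'k \<Rightarrow> real"
    and P :: "real^'k^'m" and Q :: "real^'n^'k"
  assumes "A \<noteq> 0" and "lam > 0"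
    and "c1 = 3" and "c2 = norm A"
    and "g = (\<lambda>U Z. 1 / 2 * (norm (A - U ** Z))\<^sup>2)"
    and "f = (\<lambda>U Z. nonneg_ind U + nonneg_ind Z)"
    and "h = (\<lambda>U Z. c1 * (((norm U)\<^sup>2 + (norm Z)\<^sup>2) / 2)\<^sup>2
                    + c2 * (((norm U)\<^sup>2 + (norm Z)\<^sup>2) / 2))"
    and "P = bpg_P lam g h Uk Zk" and "Q = bpg_Q lam g h Uk Zk"
  shows "(\<exists>r\<ge>0. c1 * ((norm (Pi_plus (- Q)))\<^sup>2 + (norm (Pi_plus (- P)))\<^sup>2) * r ^ 3 + c2 * r - 1 = 0)
    \<and> (\<forall>r\<ge>0. c1 * ((norm (Pi_plus (- Q)))\<^sup>2 + (norm (Pi_plus (- P)))\<^sup>2) * r ^ 3 + c2 * r - 1 = 0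
          \<longrightarrow> bpg_mf_update lam f g h Uk Zk = {(r *\<^sub>R Pi_plus (- P), r *\<^sub>R Pi_plus (- Q))})"
proof -
  have "c1 \<ge> 0" "c2 > 0" using assms(1,3,4) by simp_all
  have "bpg_mf_update lam f g h Uk Zk = {(r *\<^sub>R Pi_plus (- P), r *\<^sub>R Pi_plus (- Q))}"
    if "r \<ge> 0"
      "c1 * ((norm (Pi_plus (- Q)))\<^sup>2 + (norm (Pi_plus (- P)))\<^sup>2) * r ^ 3 + c2 * r - 1 = 0" for r
    using nonneg_quartic_argmin[OF \<open>lam > 0\<close> \<open>c1 \<ge> 0\<close> \<open>c2 > 0\<close> that]
    \<comment> \<open>\<open>P\<close> and \<open>Q\<close> are folded first, so that unfolding \<open>h\<close> leaves their definitions alone.\<close>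
    unfolding bpg_mf_update_def unfolding assms(8,9)[symmetric] unfolding assms(6,7) .
  then show ?thesis
    using cubic_has_nonneg_root \<open>c1 \<ge> 0\<close> \<open>c2 > 0\<close> by simp
qed

end
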